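(* Let $n>k\ge 1$ be integers and let $H$ be a global maximizer of $\operatorname{vol}_k([-1,1]^n\cap H)$ over all $k$-dimensional linear subspaces $H$ of $\mathbb{R}^n$. Let $v$ be the orthogonal projection of a vector of the standard basis of $\mathbb{R}^n$ onto $H$. Then $$\frac{k}{n+k}\le |v|^2\le\frac{k}{n-k}.$$
   Context: $\operatorname{vol}_k$ is $k$-dimensional volume and $|\cdot|$ is the Euclidean norm. *)

theory Defs
  imports "HOL-Analysis.Analysis"
begin

definition linear_isometry_onto ::
    "('a::euclidean_space \<Rightarrow> 'b::euclidean_space) \<Rightarrow> 'b set \<Rightarrow> bool" where
  "linear_isometry_onto f H \<longleftrightarrow> linear f \<and> (\<forall>x. norm (f x) = norm x) \<and> range f = H"

text \<open>
  The \<open>CARD('k)\<close>-dimensional volume of the part of \<open>S\<close> lying in a linear subspace \<open>H\<close> of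
  dimension \<open>CARD('k)\<close>: identify \<open>H\<close> isometrically with \<open>real ^ 'k\<close> and take Lebesgue
  measure there. Existence of the isometry and independence of its choice are the lemmas
  \<open>linear_isometry_onto_exists\<close> and \<open>subspace_volume_eq\<close> below. The value is meaningless
  if the dimension of \<open>H\<close> is not \<open>CARD('k)\<close>.
\<close>
definition subspace_volume ::
    "'k::finite itself \<Rightarrow> (real ^ 'n::finite) set \<Rightarrow> (real ^ 'n) set \<Rightarrow> ennreal" where
  "subspace_volume (_ :: 'k itself) H S =
     emeasure lebesgue ((SOME f :: real ^ 'k \<Rightarrow> real ^ 'n. linear_isometry_onto f H) -` S)"

definition cube :: "(real ^ 'n::finite) set" where
  "cube = {x. \<forall>i. x $ i \<in> {-1..1}}"

definition is_orthogonal_projection ::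
    "'a::euclidean_space set \<Rightarrow> 'a \<Rightarrow> 'a \<Rightarrow> bool" where
  "is_orthogonal_projection H x v \<longleftrightarrow> v \<in> H \<and> (\<forall>w\<in>H. orthogonal (x - v) w)"

lemma linear_isometry_onto_exists:
  fixes H :: "(real ^ 'n::finite) set"
  assumes "subspace H" "dim H = CARD('k::finite)"
  shows "\<exists>f :: real ^ 'k \<Rightarrow> real ^ 'n. linear_isometry_onto f H"
proof -
  have "dim (UNIV :: (real ^ 'k) set) = dim H" using assms by simp
  then obtain f :: "real ^ 'k \<Rightarrow> real ^ 'n" and g
    where "linear f" "f ` UNIV = H" "\<And>x. x \<in> UNIV \<Longrightarrow> norm (f x) = norm x"
    using isometries_subspaces[of "UNIV :: (real ^ 'k) set" H] assms(1) subspace_UNIV by metis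
  then show ?thesis unfolding linear_isometry_onto_def by blast
qed

lemma emeasure_lborel_orthogonal_vimage:
  fixes g :: "'a::euclidean_space \<Rightarrow> 'a"
  assumes g: "orthogonal_transformation g" and A: "A \<in> sets borel"
  shows "emeasure lborel (g -` A) = emeasure lborel A"
proof -
  have [measurable]: "g \<in> borel_measurable borel"
    using g by (intro borel_measurable_continuous_onI linear_continuous_on)
      (simp add: linear_conv_bounded_linear[symmetric] orthogonal_transformation_linear)
  have [measurable]: "A \<in> sets borel" by (rule A)
  define B where "B = (ball 0 1 :: 'a set)"
  have [measurable]: "B \<in> sets borel" by (simp add: B_def)
  have trans: "(\<integral>\<^sup>+y. F (y + c) \<partial>lborel) = (\<integral>\<^sup>+y. F y \<partial>lborel)"
    if [measurable]: "F \<in> borel_measurable borel" for F :: "'a \<Rightarrow> ennreal" and c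
    by (subst (2) lborel_distr_plus[of c, symmetric], subst nn_integral_distr)
      (auto simp: add.commute)
  have distr_refl: "distr lborel borel (\<lambda>y. c - y) = (lborel :: 'a measure)" for c :: 'a
    by (subst lborel_affine[of "-1" c]) (auto simp: density_1)
  have refl: "(\<integral>\<^sup>+y. F (c - y) \<partial>lborel) = (\<integral>\<^sup>+y. F y \<partial>lborel)"
    if [measurable]: "F \<in> borel_measurable borel" for F :: "'a \<Rightarrow> ennreal" and c
    by (subst (2) distr_refl[of c, symmetric], subst nn_integral_distr) auto
  have em: "(\<integral>\<^sup>+x. indicator C (g x) \<partial>lborel) = emeasure lborel (g -` C)"
    if [measurable]: "C \<in> sets borel" for C :: "'a set"
  proof -
    have "g -` C \<in> sets borel" using measurable_sets_borel[of g borel C] by simp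
    moreover have "(\<lambda>x. indicator C (g x) :: ennreal) = indicator (g -` C)"
      by (auto simp: indicator_def fun_eq_iff)
    ultimately show ?thesis by simp
  qed
  obtain g' where gg': "\<And>y. g (g' y) = y"
    using orthogonal_transformation_surj[OF g] by (metis surj_f_inv_f)
  have diff: "g (x - g' y) = g x - y" for x y
    using gg' linear_diff[OF orthogonal_transformation_linear[OF g]] by simp
  have "emeasure lborel (g -` A) * emeasure lborel B
      = (\<integral>\<^sup>+x. indicator A (g x) * emeasure lborel B \<partial>lborel)"
    using em[of A] by (subst nn_integral_multc) auto
  also have "\<dots> = (\<integral>\<^sup>+x. (\<integral>\<^sup>+y. indicator A (g x) * indicator B (y + g x) \<partial>lborel) \<partial>lborel)"
    by (rule nn_integral_cong, subst nn_integral_cmult, measurable, subst trans) auto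
  also have "\<dots> = (\<integral>\<^sup>+y. (\<integral>\<^sup>+x. indicator A (g x) * indicator B (y + g x) \<partial>lborel) \<partial>lborel)"
    by (rule lborel_pair.Fubini'[symmetric]) measurable
  also have "\<dots> = (\<integral>\<^sup>+y. (\<integral>\<^sup>+x. indicator A (g x - y) * indicator B (g x) \<partial>lborel) \<partial>lborel)"
  proof (rule nn_integral_cong)
    fix y
    show "(\<integral>\<^sup>+x. indicator A (g x) * indicator B (y + g x) \<partial>lborel)
        = (\<integral>\<^sup>+x. indicator A (g x - y) * (indicator B (g x) :: ennreal) \<partial>lborel)"
      by (subst trans[of _ "- g' y", symmetric]) (measurable, simp add: diff)
  qed
  also have "\<dots> = (\<integral>\<^sup>+x. (\<integral>\<^sup>+y. indicator A (g x - y) * indicator B (g x) \<partial>lborel) \<partial>lborel)"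
    by (rule lborel_pair.Fubini') measurable
  also have "\<dots> = (\<integral>\<^sup>+x. emeasure lborel A * indicator B (g x) \<partial>lborel)"
    by (rule nn_integral_cong, subst nn_integral_multc, measurable, subst refl) auto
  also have "\<dots> = emeasure lborel A * emeasure lborel (g -` B)"
    using em[of B] by (subst nn_integral_cmult) auto
  also have "g -` B = B"
    using g by (auto simp: B_def orthogonal_transformation_norm)
  finally have "emeasure lborel (g -` A) * emeasure lborel B
      = emeasure lborel A * emeasure lborel B" .
  moreover have "emeasure lborel B \<noteq> \<infinity>"
    using emeasure_lborel_ball_finite[of "0::'a" 1] by (simp add: B_def)
  moreover have "emeasure lborel B \<noteq> 0"
    using content_ball_pos[of 1 "0::'a"] by (auto simp: B_def measure_def)
  ultimately show ?thesis
    by (metis ennreal_mult_divide_eq infinity_ennreal_def top.not_eq_extremum)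
qed

lemma emeasure_lebesgue_orthogonal_vimage:
  fixes g :: "'a::euclidean_space \<Rightarrow> 'a"
  assumes g: "orthogonal_transformation g"
  shows "emeasure lebesgue (g -` T) = emeasure lebesgue T"
proof -
  have meas: "h \<in> lebesgue \<rightarrow>\<^sub>M lebesgue" and
    em: "A \<in> sets lebesgue \<Longrightarrow> emeasure lebesgue (h -` A) = emeasure lebesgue A"
    if h: "orthogonal_transformation h" for h :: "'a \<Rightarrow> 'a" and A
  proof -
    have hb: "h \<in> borel_measurable borel"
      using h by (intro borel_measurable_continuous_onI linear_continuous_on)
        (simp add: linear_conv_bounded_linear[symmetric] orthogonal_transformation_linear)
    have eq: "distr lborel lborel h = lborel"
      using hb emeasure_lborel_orthogonal_vimage[OF h]
      by (intro measure_eqI) (auto simp: emeasure_distr)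
    have eq': "distr lebesgue lborel h = lborel"
      using hb eq by (simp add: distr_completion)
    show m: "h \<in> lebesgue \<rightarrow>\<^sub>M lebesgue"
      using hb by (intro completion.measurable_completion2)
        (auto simp: eq' measurable_completion)
    have "completion (distr lebesgue lborel h) = distr lebesgue lebesgue h"
      using hb by (intro completion.completion_distr_eq) (auto simp: eq' measurable_completion)
    then have d: "distr lebesgue lebesgue h = lebesgue" by (simp add: eq')
    show "emeasure lebesgue (h -` A) = emeasure lebesgue A" if "A \<in> sets lebesgue"
      using emeasure_distr[OF m that] by (simp add: d)
  qed
  show ?thesis
  proof (cases "T \<in> sets lebesgue")
    case True
    then show ?thesis by (rule em[OF g])
  next
    case False
    have "inv g -` (g -` T) = T"
      using orthogonal_transformation_surj[OF g] by (auto simp: surj_f_inv_f)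
    then have "g -` T \<notin> sets lebesgue"
      using False measurable_sets[OF meas[OF orthogonal_transformation_inv[OF g]], of "g -` T"]
      by auto
    then show ?thesis using False by (simp add: emeasure_notin_sets)
  qed
qed

lemma subspace_volume_eq:
  fixes f :: "real ^ 'k::finite \<Rightarrow> real ^ 'n::finite"
  assumes f: "linear_isometry_onto f H"
  shows "subspace_volume TYPE('k) H S = emeasure lebesgue (f -` S)"
proof -
  define h where "h = (SOME f :: real ^ 'k \<Rightarrow> real ^ 'n. linear_isometry_onto f H)"
  have h: "linear_isometry_onto h H" unfolding h_def using f by (rule someI[where P = "\<lambda>f. linear_isometry_onto f H"])
  have linf: "linear f" and nf: "\<And>x. norm (f x) = norm x" and rf: "range f = H"
    using f by (auto simp: linear_isometry_onto_def)
  have linh: "linear h" and nh: "\<And>x. norm (h x) = norm x" and rh: "range h = H"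
    using h by (auto simp: linear_isometry_onto_def)
  have injf: "inj f"
    using linf nf by (metis linear_injective_0 norm_eq_zero)
  define g where "g = (\<lambda>x. inv f (h x))"
  have fg: "f (g x) = h x" for x
    unfolding g_def using rf rh by (metis f_inv_into_f rangeI)
  have "linear g"
  proof (rule linearI)
    fix x y c
    show "g (x + y) = g x + g y"
      using injf by (metis fg injD linear_add linf linh)
    show "g (c *\<^sub>R x) = c *\<^sub>R g x" for c :: real
      using injf by (metis fg injD linear_cmul linf linh)
  qed
  moreover have "norm (g x) = norm x" for x
    using nf nh fg by metis
  ultimately have g: "orthogonal_transformation g"
    by (simp add: orthogonal_transformation)
  have "h -` S = g -` (f -` S)" using fg by auto
  then show ?thesis
    unfolding subspace_volume_def h_def[symmetric]
    using emeasure_lebesgue_orthogonal_vimage[OF g] by simp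
qed

end

theory Submission
  imports Defs
begin

text \<open>
  Identify \<open>H\<close> with \<open>real ^ 'k\<close> by a linear isometry \<open>f\<close> and write \<open>f x $ l = a l \<bullet> x\<close>. The
  vectors \<open>a l\<close> correspond to the projections of the standard basis onto \<open>H\<close>, they satisfy
  \<open>\<Sum>l. (a l \<bullet> x) * (a l \<bullet> y) = x \<bullet> y\<close>, and the section of the cube becomes
  \<open>Q = {x. \<forall>l. \<bar>a l \<bullet> x\<bar> \<le> 1}\<close>.

  The idea is to replace one vector \<open>a i\<close> of this family by another one, \<open>a j\<close>. This drops a
  constraint and repeats another, so the set cut out by the new family contains \<open>Q\<close>. It is
  the preimage of the cube under the linear map \<open>g\<close> whose rows are the new family, and the
  section of the cube by \<open>range g\<close> has its volume multiplied by the square root of the Gram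
  determinant of \<open>g\<close>. As \<open>H\<close> is a maximizer, that determinant is at most 1. The Gram form of
  \<open>g\<close> is the inner product minus the square of \<open>a i\<close> plus the square of \<open>a j\<close>, and its
  determinant is \<open>(1 - |a i|^2) * (1 + |a j|^2) + (a i \<bullet> a j)^2\<close>. Hence this number is at
  most 1 for all \<open>i\<close> and \<open>j\<close> (\<open>row_replacement_inequality\<close>).

  Both bounds follow by averaging. The squares \<open>|a j|^2\<close> sum to \<open>k\<close> and the squares
  \<open>(a i \<bullet> a j)^2\<close> sum over \<open>j\<close> to \<open>|a i|^2\<close>. With \<open>\<alpha> = |a i|^2\<close>, summing over the added
  vector \<open>j\<close> gives \<open>(1 - \<alpha>) * (n + k) + \<alpha> \<le> n\<close>, and summing over the removed vector, with
  \<open>a i\<close> as the added one, gives \<open>(n - k) * (1 + \<alpha>) + \<alpha> \<le> n\<close>.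

  The volume factor is obtained without determinants of matrices. A linear bijection \<open>T\<close> of
  \<open>real ^ 'k\<close> with \<open>T x \<bullet> T y = g x \<bullet> g y\<close> makes \<open>g \<circ> inv T\<close> an isometry onto \<open>range g\<close>, and
  such a \<open>T\<close> is built from two stretches along single directions
  (\<open>rank_two_change_of_inner_product\<close>).
\<close>

section \<open>Stretching along a vector\<close>

text \<open>
  For a unit vector \<open>e\<close>: multiplication by \<open>\<mu>\<close> along \<open>e\<close>, and the identity on the orthogonal
  complement of \<open>e\<close>.
\<close>
definition stretch :: "'a::real_inner \<Rightarrow> real \<Rightarrow> 'a \<Rightarrow> 'a" where
  "stretch e \<mu> x = x + ((\<mu> - 1) * (e \<bullet> x)) *\<^sub>R e"

lemma linear_stretch: "linear (stretch e \<mu>)"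
  by (rule linearI) (auto simp: stretch_def algebra_simps inner_add_right)

lemma stretch_stretch:
  assumes "norm e = 1"
  shows "stretch e \<mu> (stretch e \<nu> x) = stretch e (\<mu> * \<nu>) x"
proof -
  have "e \<bullet> e = 1" using assms by (simp add: dot_square_norm)
  then have "e \<bullet> stretch e \<nu> x = \<nu> * (e \<bullet> x)"
    by (simp add: stretch_def inner_add_right algebra_simps)
  then have "stretch e \<mu> (stretch e \<nu> x)
      = x + ((\<nu> - 1) * (e \<bullet> x) + (\<mu> - 1) * (\<nu> * (e \<bullet> x))) *\<^sub>R e"
    by (simp add: stretch_def[of e \<mu>] stretch_def[of e \<nu> x] scaleR_left.add)
  also have "(\<nu> - 1) * (e \<bullet> x) + (\<mu> - 1) * (\<nu> * (e \<bullet> x)) = (\<mu> * \<nu> - 1) * (e \<bullet> x)"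
    by (simp add: algebra_simps)
  finally show ?thesis by (simp add: stretch_def)
qed

lemma bij_stretch:
  assumes "norm e = 1" "\<mu> \<noteq> 0"
  shows "bij (stretch e \<mu>)"
  by (rule o_bij[of "stretch e (1 / \<mu>)"])
    (use assms in \<open>simp_all add: fun_eq_iff stretch_stretch\<close>, simp_all add: stretch_def)

lemma inner_stretch:
  assumes "norm e = 1"
  shows "stretch e \<mu> x \<bullet> stretch e \<mu> y = x \<bullet> y + (\<mu>\<^sup>2 - 1) * (e \<bullet> x) * (e \<bullet> y)"
proof -
  have "e \<bullet> e = 1" using assms by (simp add: dot_square_norm)
  moreover have "x \<bullet> e = e \<bullet> x" by (rule inner_commute)
  ultimately show ?thesis
    unfolding stretch_def inner_add_left inner_add_right inner_scaleR_left inner_scaleR_right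
    by (simp add: algebra_simps power2_eq_square)
qed

lemma emeasure_lborel_vimage_stretch_Basis:
  fixes b :: "'a::euclidean_space"
  assumes b: "b \<in> Basis" and \<mu>: "\<mu> > 0" and A: "A \<in> sets borel"
  shows "ennreal \<mu> * emeasure lborel (stretch b \<mu> -` A) = emeasure lborel A"
proof -
  define c where "c j = (if j = b then \<mu> else 1)" for j :: 'a
  have eq: "stretch b \<mu> = (\<lambda>x. 0 + (\<Sum>j\<in>Basis. (c j * (x \<bullet> j)) *\<^sub>R j))"
  proof
    fix x
    have "(\<Sum>j\<in>Basis. (c j * (x \<bullet> j)) *\<^sub>R j)
        = (\<Sum>j\<in>Basis. (x \<bullet> j) *\<^sub>R j + (if j = b then ((\<mu> - 1) * (x \<bullet> j)) *\<^sub>R j else 0))"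
      by (intro sum.cong) (auto simp: c_def algebra_simps)
    then show "stretch b \<mu> x = 0 + (\<Sum>j\<in>Basis. (c j * (x \<bullet> j)) *\<^sub>R j)"
      using b by (simp add: sum.distrib euclidean_representation stretch_def inner_commute[of b])
  qed
  have c0: "\<And>j. j \<in> Basis \<Longrightarrow> c j \<noteq> 0" using \<mu> by (simp add: c_def)
  have prod: "(\<Prod>j\<in>Basis. \<bar>c j\<bar>) = \<mu>"
    using b \<mu> by (simp add: c_def prod.If_cases if_distrib[of abs] cong: if_cong)
  have lb: "lborel = density (distr lborel borel (stretch b \<mu>)) (\<lambda>_. ennreal \<mu>)"
    using lborel_affine_euclidean[of c 0, OF c0] by (simp only: eq prod)
  have "stretch b \<mu> \<in> borel_measurable borel"
    unfolding stretch_def[abs_def] by measurable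
  then have "emeasure (density (distr lborel borel (stretch b \<mu>)) (\<lambda>_. ennreal \<mu>)) A
     = ennreal \<mu> * emeasure lborel (stretch b \<mu> -` A)"
    using A by (subst emeasure_density_const) (auto simp: emeasure_distr)
  then show ?thesis by (simp flip: lb)
qed

text \<open>
  An orthogonal map takes a coordinate vector to \<open>e\<close>, and it conjugates the stretch along
  that coordinate, which is diagonal, to the stretch along \<open>e\<close>.
\<close>
lemma emeasure_lborel_vimage_stretch:
  fixes e :: "real ^ 'k::finite"
  assumes e: "norm e = 1" and \<mu>: "\<mu> > 0" and A: "A \<in> sets borel"
  shows "ennreal \<mu> * emeasure lborel (stretch e \<mu> -` A) = emeasure lborel A"
proof -
  obtain b :: "real ^ 'k" where b: "b \<in> Basis" using nonempty_Basis by blast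
  then obtain R where R: "orthogonal_transformation R" and Re: "R b = e"
    using orthogonal_transformation_exists_1[of b e] e by auto
  have RR: "R x \<bullet> R y = x \<bullet> y" for x y
    using R by (simp add: orthogonal_transformation_def)
  have conj: "stretch e \<mu> (R x) = R (stretch b \<mu> x)" for x
    using orthogonal_transformation_linear[OF R]
    by (simp add: stretch_def linear_add linear_cmul RR flip: Re)
  have meas: "stretch e \<mu> \<in> borel_measurable borel" "R \<in> borel_measurable borel"
    using R by (auto intro!: borel_measurable_continuous_onI linear_continuous_on
        simp: linear_conv_bounded_linear[symmetric] orthogonal_transformation_linear linear_stretch)
  have S: "stretch e \<mu> -` A \<in> sets borel" and RA: "R -` A \<in> sets borel"
    using measurable_sets_borel[OF meas(1) A] measurable_sets_borel[OF meas(2) A] by auto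
  have "emeasure lborel (stretch e \<mu> -` A) = emeasure lborel (R -` stretch e \<mu> -` A)"
    by (rule emeasure_lborel_orthogonal_vimage[OF R S, symmetric])
  also have "R -` stretch e \<mu> -` A = stretch b \<mu> -` R -` A"
    by (auto simp: conj)
  finally show ?thesis
    using emeasure_lborel_vimage_stretch_Basis[OF b \<mu> RA]
      emeasure_lborel_orthogonal_vimage[OF R A] by simp
qed

text \<open>
  The map \<open>T\<close> is the stretch along \<open>w\<close> by the square root of \<open>1 + d * |w|^2\<close>, the determinant
  of the new inner product.
\<close>
lemma rank_one_change_of_inner_product:
  fixes w :: "real ^ 'k::finite"
  assumes pos: "1 + d * (norm w)\<^sup>2 > 0"
  obtains T :: "real ^ 'k \<Rightarrow> real ^ 'k" where "linear T" "bij T"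
    "\<And>x y. T x \<bullet> T y = x \<bullet> y + d * (w \<bullet> x) * (w \<bullet> y)"
    "\<And>A. A \<in> sets borel \<Longrightarrow>
       ennreal (sqrt (1 + d * (norm w)\<^sup>2)) * emeasure lborel (T -` A) = emeasure lborel A"
proof (cases "w = 0")
  case True
  then show ?thesis using that[of id] by (simp add: linear_id)
next
  case False
  define e where "e = w /\<^sub>R norm w"
  define \<mu> where "\<mu> = sqrt (1 + d * (norm w)\<^sup>2)"
  have e: "norm e = 1" using False by (simp add: e_def)
  have \<mu>: "\<mu> > 0" using pos by (simp add: \<mu>_def)
  have "(\<mu>\<^sup>2 - 1) * (e \<bullet> x) * (e \<bullet> y) = d * (w \<bullet> x) * (w \<bullet> y)" for x y
    using pos False by (simp add: \<mu>_def e_def field_simps power2_eq_square)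
  then show ?thesis
    using that[OF linear_stretch[of e \<mu>] bij_stretch[OF e]] \<mu>
      emeasure_lborel_vimage_stretch[OF e \<mu>] inner_stretch[OF e, of \<mu>]
    unfolding \<mu>_def by simp
qed

text \<open>
  First the square of \<open>w\<close> is added by a map \<open>T1\<close>. With respect to the new inner product the
  functional \<open>u \<bullet> x\<close> is represented by another vector \<open>z\<close>, that is, it equals
  \<open>T1 z \<bullet> T1 x\<close>. A second rank one change, which subtracts the square of \<open>T1 z\<close>, is then
  composed with \<open>T1\<close>. The number \<open>D\<close> is the determinant of the resulting form. Its sign
  decides whether the second change is possible.
\<close>
lemma rank_two_change_of_inner_product:
  fixes u w :: "real ^ 'k::finite"
  defines "D \<equiv> (1 - (norm u)\<^sup>2) * (1 + (norm w)\<^sup>2) + (u \<bullet> w)\<^sup>2"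
  assumes D: "D > 0"
  obtains T :: "real ^ 'k \<Rightarrow> real ^ 'k" where "linear T" "bij T"
    "\<And>x y. T x \<bullet> T y = x \<bullet> y - (u \<bullet> x) * (u \<bullet> y) + (w \<bullet> x) * (w \<bullet> y)"
    "\<And>A. A \<in> sets borel \<Longrightarrow>
       ennreal (sqrt D) * emeasure lborel (T -` A) = emeasure lborel A"
proof -
  define \<beta> where "\<beta> = 1 + (norm w)\<^sup>2"
  have \<beta>: "\<beta> > 0" by (simp add: \<beta>_def add_pos_nonneg)
  obtain T1 :: "real ^ 'k \<Rightarrow> real ^ 'k" where lin1: "linear T1" and bij1: "bij T1"
    and in1: "\<And>x y. T1 x \<bullet> T1 y = x \<bullet> y + (w \<bullet> x) * (w \<bullet> y)"
    and em1: "\<And>A. A \<in> sets borel \<Longrightarrow>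
       ennreal (sqrt \<beta>) * emeasure lborel (T1 -` A) = emeasure lborel A"
    using rank_one_change_of_inner_product[of 1 w] \<beta> unfolding \<beta>_def by auto
  \<comment> \<open>The vector \<open>z\<close> solves \<open>z + (w \<bullet> z) *\<^sub>R w = u\<close>.\<close>
  define z where "z = u - ((u \<bullet> w) / \<beta>) *\<^sub>R w"
  have ww: "w \<bullet> w = \<beta> - 1" by (simp add: \<beta>_def dot_square_norm)
  have wz: "w \<bullet> z = (u \<bullet> w) / \<beta>"
    using \<beta> by (simp add: z_def inner_diff_right ww inner_commute[of w u] field_simps)
  have u': "T1 z \<bullet> T1 x = u \<bullet> x" for x
    unfolding in1 wz by (simp add: z_def inner_diff_left)
  have "(norm (T1 z))\<^sup>2 = u \<bullet> z"
    using u'[of z] by (simp add: dot_square_norm)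
  also have "u \<bullet> z = (norm u)\<^sup>2 - (u \<bullet> w)\<^sup>2 / \<beta>"
    by (simp add: z_def inner_diff_right dot_square_norm power2_eq_square)
  finally have D_eq: "D = \<beta> * (1 + - 1 * (norm (T1 z))\<^sup>2)"
    using \<beta> by (simp add: D_def field_simps flip: \<beta>_def)
  then have pos2: "1 + - 1 * (norm (T1 z))\<^sup>2 > 0"
    using D \<beta> by (simp add: zero_less_mult_iff)
  obtain T2 :: "real ^ 'k \<Rightarrow> real ^ 'k" where lin2: "linear T2" and bij2: "bij T2"
    and in2: "\<And>x y. T2 x \<bullet> T2 y = x \<bullet> y + - 1 * (T1 z \<bullet> x) * (T1 z \<bullet> y)"
    and em2: "\<And>A. A \<in> sets borel \<Longrightarrow>
       ennreal (sqrt (1 + - 1 * (norm (T1 z))\<^sup>2)) * emeasure lborel (T2 -` A) = emeasure lborel A"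
    using rank_one_change_of_inner_product[OF pos2] by blast
  have "ennreal (sqrt D) * emeasure lborel ((T2 \<circ> T1) -` A) = emeasure lborel A"
    if A: "A \<in> sets borel" for A
  proof -
    have "T2 \<in> borel_measurable borel"
      using lin2 by (intro borel_measurable_continuous_onI linear_continuous_on)
        (simp add: linear_conv_bounded_linear[symmetric])
    then have "T2 -` A \<in> sets borel"
      using measurable_sets_borel[OF _ A] by auto
    then have "emeasure lborel A = ennreal (sqrt (1 + - 1 * (norm (T1 z))\<^sup>2))
        * (ennreal (sqrt \<beta>) * emeasure lborel (T1 -` T2 -` A))"
      by (simp only: em1 em2[OF A])
    then show ?thesis
      using \<beta> pos2 by (simp add: D_eq real_sqrt_mult ennreal_mult vimage_comp[symmetric] ac_simps)
  qed
  then show ?thesis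
    using that[of "T2 \<circ> T1"] linear_compose[OF lin1 lin2] bij_comp[OF bij1 bij2]
    by (simp add: in2 u') (simp add: in1)
qed

section \<open>Sections of the cube\<close>

lemma subspace_volume_eq_vimage:
  fixes f :: "real ^ 'k::finite \<Rightarrow> real ^ 'n::finite"
  assumes f: "linear_isometry_onto f H" and S: "closed S"
  shows "subspace_volume TYPE('k) H (S \<inter> H) = emeasure lborel (f -` S)"
proof -
  have "continuous_on UNIV f"
    using f by (intro linear_continuous_on)
      (simp add: linear_isometry_onto_def linear_conv_bounded_linear[symmetric])
  then have "closed (f -` S)" using S by (simp add: closed_vimage)
  moreover have "f -` (S \<inter> H) = f -` S"
    using f by (auto simp: linear_isometry_onto_def)
  ultimately show ?thesis by (simp add: subspace_volume_eq[OF f])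
qed

lemma closed_cube: "closed (cube :: (real ^ 'n::finite) set)"
proof -
  have "(cube :: (real ^ 'n) set) = cbox (- 1) 1"
    by (auto simp: cube_def mem_box_cart)
  then show ?thesis by (metis closed_cbox)
qed

lemma emeasure_cube_section_pos_finite:
  fixes f :: "real ^ 'k::finite \<Rightarrow> real ^ 'n::finite"
  assumes "linear_isometry_onto f H"
  shows "0 < emeasure lborel (f -` cube)" and "emeasure lborel (f -` cube) < \<infinity>"
proof -
  have lin: "linear f" and n: "\<And>x. norm (f x) = norm x"
    using assms by (auto simp: linear_isometry_onto_def)
  have "cball 0 1 \<subseteq> f -` cube"
  proof
    fix x :: "real ^ 'k" assume "x \<in> cball 0 1"
    then have "\<bar>f x $ l\<bar> \<le> 1" for l
      using component_le_norm_cart[of "f x" l] by (simp add: n)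
    then show "x \<in> f -` cube" by (auto simp: cube_def abs_le_iff minus_le_iff)
  qed
  moreover have cl: "closed (f -` cube)"
    using lin closed_cube
    by (intro closed_vimage linear_continuous_on) (auto simp: linear_conv_bounded_linear)
  ultimately have "emeasure lborel (cball (0 :: real ^ 'k) 1) \<le> emeasure lborel (f -` cube)"
    by (intro emeasure_mono) auto
  moreover have "emeasure lborel (cball (0 :: real ^ 'k) 1) > 0"
    using content_cball_pos[of 1 "0 :: real ^ 'k"]
    by (metis emeasure_lborel_cball_finite ennreal_0 measure_def enn2real_positive_iff zero_less_one)
  ultimately show "0 < emeasure lborel (f -` cube)" by (rule less_le_trans[rotated])
  have "bounded (f -` cube)"
  proof (rule boundedI)
    fix x assume "x \<in> f -` cube"
    then have "\<bar>f x $ l\<bar> \<le> 1" for l by (auto simp: cube_def abs_le_iff minus_le_iff)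
    then have "(\<Sum>l\<in>UNIV. \<bar>f x $ l\<bar>) \<le> (\<Sum>l\<in>(UNIV::'n set). 1)" by (intro sum_mono)
    then show "norm x \<le> real CARD('n)"
      using norm_le_l1_cart[of "f x"] by (simp add: n)
  qed
  with cl have "compact (f -` cube)" by (simp add: compact_eq_bounded_closed)
  then show "emeasure lborel (f -` cube) < \<infinity>"
    by (simp add: emeasure_compact_finite[simplified])
qed

text \<open>
  If the determinant exceeded 1, then \<open>range g\<close> would be a better subspace: its section has
  the volume of \<open>g -` cube\<close>, which is at least that of \<open>f -` cube\<close>, times the square root of
  the determinant. The contradiction uses that the maximal volume is positive and finite.
\<close>
lemma rank_two_det_le_1_of_maximal:
  fixes f g :: "real ^ 'k::finite \<Rightarrow> real ^ 'n::finite"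
  assumes f: "linear_isometry_onto f H"
        and max: "\<And>(h :: real ^ 'k \<Rightarrow> real ^ 'n) H'. linear_isometry_onto h H' \<Longrightarrow>
       emeasure lborel (h -` cube) \<le> emeasure lborel (f -` cube)"
    and g: "linear g"
    and gram: "\<And>x y. g x \<bullet> g y = x \<bullet> y - (u \<bullet> x) * (u \<bullet> y) + (w \<bullet> x) * (w \<bullet> y)"
    and larger: "f -` cube \<subseteq> g -` cube"
  shows "(1 - (norm u)\<^sup>2) * (1 + (norm w)\<^sup>2) + (u \<bullet> w)\<^sup>2 \<le> 1" (is "?D \<le> 1")
proof (rule ccontr)
  assume "\<not> ?D \<le> 1"
  then have D1: "?D > 1" by simp
  then have "?D > 0" by linarith
  then obtain T :: "real ^ 'k \<Rightarrow> real ^ 'k" where lin: "linear T" and bij: "bij T"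
    and inT: "\<And>x y. T x \<bullet> T y = x \<bullet> y - (u \<bullet> x) * (u \<bullet> y) + (w \<bullet> x) * (w \<bullet> y)"
    and em: "\<And>A. A \<in> sets borel \<Longrightarrow>
       ennreal (sqrt ?D) * emeasure lborel (T -` A) = emeasure lborel A"
    by (rule rank_two_change_of_inner_product) blast
  \<comment> \<open>\<open>T\<close> has the same Gram form as \<open>g\<close>, so \<open>h\<close> preserves the inner product.\<close>
  define h where "h = g \<circ> inv T"
  have T_inv: "T (inv T x) = x" for x
    using bij by (simp add: bij_is_surj surj_f_inv_f)
  have "h x \<bullet> h x = x \<bullet> x" for x
    using gram[of "inv T x" "inv T x"] inT[of "inv T x" "inv T x"] by (simp add: h_def T_inv)
  moreover have "linear (inv T)"
    using lin bij by (simp add: bij_is_inj linear_inj_imp_surj inj_linear_imp_inv_linear)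
  then have lh: "linear h"
    unfolding h_def by (rule linear_compose) (rule g)
  ultimately have h: "linear_isometry_onto h (range h)"
    by (simp add: linear_isometry_onto_def norm_eq_sqrt_inner)
  have closed: "closed (k -` cube)" if "linear k" for k :: "real ^ 'k \<Rightarrow> real ^ 'n"
    using that closed_cube
    by (intro closed_vimage linear_continuous_on) (auto simp: linear_conv_bounded_linear)
  have "g -` cube = T -` h -` cube"
    using bij by (auto simp: h_def bij_is_inj)
  then have "ennreal (sqrt ?D) * emeasure lborel (g -` cube) = emeasure lborel (h -` cube)"
    using em[of "h -` cube"] closed[OF lh] by simp
  also have "\<dots> \<le> emeasure lborel (f -` cube)"
    by (rule max[OF h])
  finally have "ennreal (sqrt ?D) * emeasure lborel (g -` cube) \<le> emeasure lborel (f -` cube)" .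
  moreover have "emeasure lborel (f -` cube) \<le> emeasure lborel (g -` cube)"
    using larger closed[OF g] by (intro emeasure_mono) auto
  ultimately have le: "ennreal (sqrt ?D) * emeasure lborel (f -` cube) \<le> emeasure lborel (f -` cube)"
    by (meson mult_left_mono order_trans zero_le)
  obtain r where r: "emeasure lborel (f -` cube) = ennreal r" "r > 0"
    using emeasure_cube_section_pos_finite[OF f]
    by (cases "emeasure lborel (f -` cube)") (auto simp: ennreal_less_zero_iff)
  have "sqrt ?D * r \<le> r"
    using le r \<open>?D > 0\<close> by (simp add: ennreal_mult[symmetric])
  then have "sqrt ?D \<le> 1" using r by simp
  then show False using D1 by simp
qed

section \<open>The projections of the standard basis\<close>

lemma inner_linear_isometry:
  fixes f :: "'a::real_inner \<Rightarrow> 'b::real_inner"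
  assumes "linear f" "\<And>x. norm (f x) = norm x"
  shows "f x \<bullet> f y = x \<bullet> y"
  by (simp add: dot_norm assms(2) flip: linear_add[OF assms(1)])

text \<open>
  The map \<open>g\<close> has the rows of \<open>f\<close>, except that row \<open>i\<close> is replaced by row \<open>j\<close>. Every row of
  \<open>g\<close> is a row of \<open>f\<close>, so the constraints defining \<open>g -` cube\<close> are among those defining
  \<open>f -` cube\<close>.
\<close>
lemma row_replacement_inequality:
  fixes f :: "real ^ 'k::finite \<Rightarrow> real ^ 'n::finite" and a :: "'n \<Rightarrow> real ^ 'k"
  assumes f: "linear_isometry_onto f H"
        and max: "\<And>(h :: real ^ 'k \<Rightarrow> real ^ 'n) H'. linear_isometry_onto h H' \<Longrightarrow>
       emeasure lborel (h -` cube) \<le> emeasure lborel (f -` cube)"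
    and a: "\<And>l x. f x $ l = a l \<bullet> x"
  shows "(1 - (norm (a i))\<^sup>2) * (1 + (norm (a j))\<^sup>2) + (a i \<bullet> a j)\<^sup>2 \<le> 1"
proof -
  have lin: "linear f" and n: "\<And>x. norm (f x) = norm x"
    using f by (auto simp: linear_isometry_onto_def)
  have ff: "f x \<bullet> f y = x \<bullet> y" for x y
    using inner_linear_isometry[OF lin n] .
  define g :: "real ^ 'k \<Rightarrow> real ^ 'n" where "g x = (\<chi> l. if l = i then a j \<bullet> x else a l \<bullet> x)" for x
  have "linear g"
    by (rule linearI) (auto simp: g_def vec_eq_iff inner_add_right)
  moreover have "g x \<bullet> g y = x \<bullet> y - (a i \<bullet> x) * (a i \<bullet> y) + (a j \<bullet> x) * (a j \<bullet> y)" for x y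
  proof -
    have "g x \<bullet> g y = (\<Sum>l\<in>UNIV. (a l \<bullet> x) * (a l \<bullet> y)
        + (if l = i then (a j \<bullet> x) * (a j \<bullet> y) - (a i \<bullet> x) * (a i \<bullet> y) else 0))"
      unfolding g_def inner_vec_def by (intro sum.cong) auto
    also have "\<dots> = f x \<bullet> f y + ((a j \<bullet> x) * (a j \<bullet> y) - (a i \<bullet> x) * (a i \<bullet> y))"
      by (simp add: sum.distrib inner_vec_def a)
    finally show ?thesis by (simp add: ff)
  qed
  moreover have "f -` cube \<subseteq> g -` cube"
    by (auto simp: cube_def g_def a)
  ultimately show ?thesis
    using rank_two_det_le_1_of_maximal[OF f] max by blast
qed

text \<open>
  The first sum is the squared Hilbert-Schmidt norm of \<open>f\<close>: computed by columns, it adds up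
  the squared norms of the images of the basis vectors.
\<close>
lemma sum_norm_rows_of_isometry:
  fixes f :: "real ^ 'k::finite \<Rightarrow> real ^ 'n::finite" and a :: "'n \<Rightarrow> real ^ 'k"
  assumes n: "\<And>x. norm (f x) = norm x" and a: "\<And>l x. f x $ l = a l \<bullet> x"
  shows "(\<Sum>l\<in>UNIV. (norm (a l))\<^sup>2) = real CARD('k)"
    and "(\<Sum>l\<in>UNIV. (a l \<bullet> x)\<^sup>2) = (norm x)\<^sup>2"
proof -
  show sq: "(\<Sum>l\<in>UNIV. (a l \<bullet> x)\<^sup>2) = (norm x)\<^sup>2" for x
  proof -
    have "(\<Sum>l\<in>UNIV. (f x $ l)\<^sup>2) = (norm (f x))\<^sup>2"
      unfolding power2_norm_eq_inner inner_vec_def by (simp add: power2_eq_square)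
    then show ?thesis by (simp add: a n)
  qed
  have "(\<Sum>l\<in>UNIV. (norm (a l))\<^sup>2) = (\<Sum>l\<in>UNIV. \<Sum>b\<in>Basis. (a l \<bullet> b)\<^sup>2)"
    unfolding power2_norm_eq_inner by (subst euclidean_inner) (simp add: power2_eq_square)
  also have "\<dots> = (\<Sum>b\<in>(Basis :: (real ^ 'k) set). (norm b)\<^sup>2)"
    by (subst sum.swap) (simp add: sq)
  finally show "(\<Sum>l\<in>UNIV. (norm (a l))\<^sup>2) = real CARD('k)" by simp
qed

theorem theorem1p2:
  fixes H :: "(real ^ 'n::finite) set" and v :: "real ^ 'n" and i :: 'n
  assumes "CARD('k::finite) < CARD('n)"
    and "subspace H" and "dim H = CARD('k)"
    and "\<And>H' :: (real ^ 'n) set. subspace H' \<Longrightarrow> dim H' = CARD('k) \<Longrightarrow>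
           subspace_volume TYPE('k) H' (cube \<inter> H') \<le> subspace_volume TYPE('k) H (cube \<inter> H)"
    and "is_orthogonal_projection H (axis i 1) v"
  shows "real CARD('k) / (real CARD('n) + real CARD('k)) \<le> (norm v)\<^sup>2
       \<and> (norm v)\<^sup>2 \<le> real CARD('k) / (real CARD('n) - real CARD('k))"
proof -
  define n where "n = real CARD('n)"
  define k where "k = real CARD('k)"
  have kn: "k < n" "k > 0" using assms(1) by (simp_all add: n_def k_def)
  obtain f :: "real ^ 'k \<Rightarrow> real ^ 'n" where f: "linear_isometry_onto f H"
    using linear_isometry_onto_exists[OF assms(2,3)] by blast
  have lin: "linear f" and nf: "\<And>x. norm (f x) = norm x" and rf: "range f = H"
    using f by (auto simp: linear_isometry_onto_def)
  have max: "emeasure lborel (h -` cube) \<le> emeasure lborel (f -` cube)"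
    if h: "linear_isometry_onto h H'" for h :: "real ^ 'k \<Rightarrow> real ^ 'n" and H'
  proof -
    have lh: "linear h" and nh: "\<And>x. norm (h x) = norm x" and rh: "range h = H'"
      using h by (auto simp: linear_isometry_onto_def)
    have "inj h" using lh nh by (metis linear_injective_0 norm_eq_zero)
    then have "dim H' = CARD('k)"
      using dim_image_eq[OF lh, of UNIV] rh by simp
    moreover have "subspace H'"
      using linear_subspace_image[OF lh subspace_UNIV] rh by simp
    ultimately show ?thesis
      using assms(4)[of H'] subspace_volume_eq_vimage[OF h closed_cube]
        subspace_volume_eq_vimage[OF f closed_cube] by simp
  qed
  define a where "a l = adjoint f (axis l 1)" for l
  have a: "f x $ l = a l \<bullet> x" for l x
    using adjoint_works[OF lin, of x "axis l 1"] by (simp add: a_def inner_axis inner_commute)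
  have ff: "f x \<bullet> f y = x \<bullet> y" for x y
    using inner_linear_isometry[OF lin nf] .
  \<comment> \<open>\<open>f\<close> maps \<open>a i\<close> to the projection of the \<open>i\<close>-th basis vector.\<close>
  have norm_v: "norm v = norm (a i)"
  proof -
    obtain y where y: "v = f y"
      using assms(5) rf by (auto simp: is_orthogonal_projection_def)
    have "x \<bullet> a i = x \<bullet> y" for x
    proof -
      have "f x \<bullet> (axis i 1 - f y) = 0"
        using assms(5) rf y
        by (auto simp: is_orthogonal_projection_def orthogonal_def inner_commute)
      then show ?thesis
        using a[of x i] by (simp add: inner_diff_right inner_axis ff inner_commute)
    qed
    then have "a i = y" using vector_eq_ldot by blast
    then show ?thesis by (simp add: y nf)
  qed
  define \<alpha> where "\<alpha> = (norm v)\<^sup>2"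
  have \<alpha>: "(norm (a i))\<^sup>2 = \<alpha>" by (simp add: \<alpha>_def norm_v)
  have s1: "(\<Sum>l\<in>UNIV. (norm (a l))\<^sup>2) = k" and s2: "(\<Sum>l\<in>UNIV. (a l \<bullet> a i)\<^sup>2) = \<alpha>"
    using sum_norm_rows_of_isometry[OF nf a] by (simp_all add: k_def \<alpha>)
  have key: "(1 - (norm (a l))\<^sup>2) * (1 + (norm (a j))\<^sup>2) + (a l \<bullet> a j)\<^sup>2 \<le> 1" for l j
    using row_replacement_inequality[OF f _ a] max by blast
  \<comment> \<open>Lower bound: row \<open>i\<close> is removed, and the added row \<open>j\<close> varies.\<close>
  have "(\<Sum>j\<in>UNIV. (1 - \<alpha>) * (1 + (norm (a j))\<^sup>2) + (a j \<bullet> a i)\<^sup>2) \<le> (\<Sum>j\<in>(UNIV::'n set). 1)"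
    using key[of i] by (intro sum_mono) (simp add: \<alpha> inner_commute)
  then have low: "(1 - \<alpha>) * (n + k) + \<alpha> \<le> n"
    by (simp add: sum.distrib s1 s2 n_def flip: sum_distrib_left)
  \<comment> \<open>Upper bound: row \<open>i\<close> is added, and the removed row \<open>j\<close> varies.\<close>
  have "(\<Sum>j\<in>UNIV. (1 - (norm (a j))\<^sup>2) * (1 + \<alpha>) + (a j \<bullet> a i)\<^sup>2) \<le> (\<Sum>j\<in>(UNIV::'n set). 1)"
    using key[of _ i] by (intro sum_mono) (simp add: \<alpha>)
  then have up: "(n - k) * (1 + \<alpha>) + \<alpha> \<le> n"
    by (simp add: sum.distrib sum_subtractf s1 s2 n_def flip: sum_distrib_right)
  have "\<alpha> \<ge> 0" by (simp add: \<alpha>_def)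
  have "k \<le> \<alpha> * (n + k)" "\<alpha> * (n - k) \<le> k"
    using low up \<open>\<alpha> \<ge> 0\<close> by (simp_all add: algebra_simps)
  then have "k / (n + k) \<le> \<alpha> \<and> \<alpha> \<le> k / (n - k)"
    using kn by (simp add: field_simps)
  then show ?thesis by (simp add: n_def k_def \<alpha>_def)
qed

end
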